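(* Let $H:\mathbb{R}\to[0,1]$ be a seed function and let $g(y)=H(y)-H(y-1)$ for every $y\in\mathbb{R}$. Let $b>1$ be real. If $g$ is the pdf of a random variable $Y$, then $Y$ is uniformly distributed modulo one, and $X= b^Y$ is $b$-Benford.
   Context: A seed function is a function $H:\mathbb{R}\to[0,1]$ such that: (1) $H(y-1)\le H(y)$ for all $y\in\mathbb{R}$; (2) $H(y)\to 0$ as $y\to-\infty$; (3) $H(y)\to 1$ as $y\to+\infty$. For $y\in\mathbb{R}$, $\langle y\rangle = y-\lfloor y\rfloor\in[0,1)$. A real random variable $Y$ is uniformly distributed modulo one (u.d. mod 1) if $\langle Y\rangle$ is uniformly distributed on $[0,1)$. For $b>1$ and $x>0$, the base $b$ significand $S_b(x)$ is the unique $s\in[1,b)$ such that $x=s\,b^k$ for some $k\in\mathbb{Z}$. A positive continuous random variable $X$ (with a pdf) is $b$-Benford if $\Pr(S_b(X)\le s)=\log_b(s)$ for all $s\in[1,b)$; equivalently, $\log_b(X)$ is u.d. mod 1. *)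

theory Defs
  imports "HOL-Probability.Probability"
begin

definition seed_function :: "(real \<Rightarrow> real) \<Rightarrow> bool" where
  "seed_function H \<longleftrightarrow>
     (\<forall>y. H y \<in> {0..1}) \<and>
     (\<forall>y. H (y - 1) \<le> H y) \<and>
     (H \<longlongrightarrow> 0) at_bot \<and>
     (H \<longlongrightarrow> 1) at_top"

text \<open>
  The nonnegativity clause is needed because \<^const>\<open>ennreal\<close> truncates negative values to 0.
\<close>
definition has_pdf :: "'a measure \<Rightarrow> ('a \<Rightarrow> real) \<Rightarrow> (real \<Rightarrow> real) \<Rightarrow> bool" where
  "has_pdf M X f \<longleftrightarrow> (\<forall>x. 0 \<le> f x) \<and> distributed M lborel X (\<lambda>x. ennreal (f x))"

definition ud_mod_one :: "'a measure \<Rightarrow> ('a \<Rightarrow> real) \<Rightarrow> bool" where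
  "ud_mod_one M Y \<longleftrightarrow>
     Y \<in> borel_measurable M \<and>
     distr M borel (\<lambda>\<omega>. frac (Y \<omega>)) = uniform_measure lborel {0..<1}"

definition significand :: "real \<Rightarrow> real \<Rightarrow> real" where
  "significand b x = (THE s. s \<in> {1..<b} \<and> (\<exists>k::int. x = s * b powi k))"

lemma significand_ex1:
  fixes b x :: real
  assumes b: "1 < b" and x: "0 < x"
  shows "\<exists>!s. s \<in> {1..<b} \<and> (\<exists>k::int. x = s * b powi k)"
proof (rule ex_ex1I)
  define k where "k = \<lfloor>log b x\<rfloor>"
  have pw: "b powi k = b powr of_int k" for k :: int
    using b by (simp add: powr_real_of_int')
  have xb: "x = b powr log b x"
    using b x by simp
  have "b powr of_int k \<le> b powr log b x" "b powr log b x < b powr (of_int k + 1)"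
    using b by (auto simp: k_def)
  then have "b powi k \<le> x" "x < b * b powi k"
    using b xb by (auto simp: pw powr_add mult.commute)
  moreover have "0 < b powi k"
    using b by simp
  ultimately have "x / b powi k \<in> {1..<b} \<and> x = x / b powi k * b powi k"
    by (auto simp: field_simps)
  then show "\<exists>s. s \<in> {1..<b} \<and> (\<exists>k::int. x = s * b powi k)"
    by blast
next
  fix s t
  assume s': "s \<in> {1..<b} \<and> (\<exists>k::int. x = s * b powi k)"
    and t': "t \<in> {1..<b} \<and> (\<exists>k::int. x = t * b powi k)"
  obtain j :: int where s: "1 \<le> s" "s < b" "x = s * b powi j"
    using s' by auto
  obtain k :: int where t: "1 \<le> t" "t < b" "x = t * b powi k"
    using t' by auto
  have floor_log: "\<lfloor>log b x\<rfloor> = i" if "1 \<le> r" "r < b" "x = r * b powi i" for r and i :: int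
  proof -
    have "log b x = log b r + of_int i"
      using b that by (simp add: log_mult powr_real_of_int' [symmetric])
    moreover have "0 \<le> log b r" "log b r < 1"
      using b that by auto
    ultimately show ?thesis
      by linarith
  qed
  have "j = k"
    using floor_log [OF s] floor_log [OF t] by simp
  then show "s = t"
    using b s(3) t(3) by simp
qed

definition benford :: "real \<Rightarrow> 'a measure \<Rightarrow> ('a \<Rightarrow> real) \<Rightarrow> bool" where
  "benford b M X \<longleftrightarrow>
     (\<forall>\<omega>\<in>space M. 0 < X \<omega>) \<and>
     (\<exists>f. has_pdf M X f) \<and>
     (\<forall>s\<in>{1..<b}. measure M {\<omega> \<in> space M. significand b (X \<omega>) \<le> s} = log b s)"

end

theory Submission
  imports Defs
begin

text \<open>
  Folding the law of \<open>Y\<close> onto \<open>[0,1)\<close> by \<^const>\<open>frac\<close> adds up all integer translates of its density, so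
  \<open>frac Y\<close> has at \<open>u \<in> [0,1)\<close> the density \<open>\<Sum>k\<in>\<int>. g (u + k)\<close>. For \<open>g y = H y - H (y - 1)\<close> this
  series telescopes to \<open>lim H at_top - lim H at_bot = 1\<close>, the uniform density. The two ingredients
  are \<open>nn_integral_lborel_periodize\<close> (folding) and \<open>nn_integral_count_space_int_telescope\<close>; as all
  terms are nonnegative, no integrability or rearrangement question arises.

  The Benford property is this statement read through \<open>y \<mapsto> b powr y\<close>: the significand of
  \<open>b powr y\<close> is \<open>b powr frac y\<close>, so it is at most \<open>s\<close> exactly when \<open>frac y \<le> log b s\<close>, an event of
  probability \<open>log b s\<close>. That \<open>b powr Y\<close> again has a density is the change of variables
  \<open>has_pdf_powr\<close>.
\<close>

section \<open>Integer translates\<close>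

text \<open>
  The symmetric windows \<open>{- n<..n}\<close> exhaust the integers, and on each of them the sum collapses to
  \<open>F n - F (- n)\<close>. Nonnegativity of the terms turns the limit of these partial sums into the full
  series.
\<close>
lemma nn_integral_count_space_int_telescope:
  fixes F :: "int \<Rightarrow> real"
  assumes mono: "\<And>k. F (k - 1) \<le> F k"
    and top: "(\<lambda>n. F (int n)) \<longlonglongrightarrow> L"
    and bot: "(\<lambda>n. F (- int n)) \<longlonglongrightarrow> l"
  shows "(\<integral>\<^sup>+k. ennreal (F k - F (k - 1)) \<partial>count_space UNIV) = ennreal (L - l)"
proof -
  let ?a = "\<lambda>k. F k - F (k - 1)"
  have sum: "(\<Sum>k\<in>{- int n<..int n}. ?a k) = F (int n) - F (- int n)" for n
  proof (induction n)
    case (Suc n)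
    have "{- int (Suc n)<..int (Suc n)} = insert (- int n) (insert (int n + 1) {- int n<..int n})"
      by auto
    then show ?case
      using Suc by (simp add: algebra_simps minus_diff_commute)
  qed simp
  have window: "(\<integral>\<^sup>+k. ennreal (?a k) * indicator {- int n<..int n} k \<partial>count_space UNIV)
      = ennreal (F (int n) - F (- int n))" for n
  proof -
    have "(\<integral>\<^sup>+k. ennreal (?a k) * indicator {- int n<..int n} k \<partial>count_space UNIV)
        = (\<Sum>k\<in>{- int n<..int n}. ennreal (?a k) * indicator {- int n<..int n} k)"
      by (rule nn_integral_count_space') auto
    also have "\<dots> = (\<Sum>k\<in>{- int n<..int n}. ennreal (?a k))"
      by (intro sum.cong) auto
    also have "\<dots> = ennreal (\<Sum>k\<in>{- int n<..int n}. ?a k)"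
      using mono by (intro sum_ennreal) auto
    finally show ?thesis
      by (simp add: sum)
  qed
  have "(\<lambda>n. \<integral>\<^sup>+k. ennreal (?a k) * indicator {- int n<..int n} k \<partial>count_space UNIV)
      \<longlonglongrightarrow> (\<integral>\<^sup>+k. ennreal (?a k) \<partial>count_space UNIV)"
  proof (rule nn_integral_LIMSEQ)
    show "incseq (\<lambda>n k. ennreal (?a k) * indicator {- int n<..int n} k)"
      by (auto simp: incseq_def le_fun_def split: split_indicator)
    fix k :: int
    have "\<forall>\<^sub>F n in sequentially. ennreal (?a k) * indicator {- int n<..int n} k = ennreal (?a k)"
      by (rule eventually_sequentiallyI[of "nat \<bar>k\<bar> + 1"]) (auto split: split_indicator)
    then show "(\<lambda>n. ennreal (?a k) * indicator {- int n<..int n} k) \<longlonglongrightarrow> ennreal (?a k)"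
      by (rule tendsto_eventually)
  qed simp
  then have "(\<lambda>n. ennreal (F (int n) - F (- int n))) \<longlonglongrightarrow> (\<integral>\<^sup>+k. ennreal (?a k) \<partial>count_space UNIV)"
    by (simp only: window)
  moreover have "(\<lambda>n. ennreal (F (int n) - F (- int n))) \<longlonglongrightarrow> ennreal (L - l)"
    by (intro tendsto_ennrealI tendsto_diff top bot)
  ultimately show ?thesis
    by (rule LIMSEQ_unique)
qed

text \<open>
  The unit intervals \<open>[k, k + 1)\<close> tile the line, and translation carries each of them to \<open>[0, 1)\<close>.
\<close>
lemma nn_integral_lborel_periodize:
  fixes f :: "real \<Rightarrow> ennreal"
  assumes [measurable]: "f \<in> borel_measurable borel"
  shows "(\<integral>\<^sup>+y. f y \<partial>lborel)
       = (\<integral>\<^sup>+u. (\<integral>\<^sup>+k. f (u + of_int k) \<partial>count_space (UNIV :: int set)) * indicator {0..<1} u \<partial>lborel)"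
proof -
  let ?I = "indicator {0..<1} :: real \<Rightarrow> ennreal"
  have tiling: "(\<integral>\<^sup>+k. ?I (y - of_int k) \<partial>count_space (UNIV :: int set)) = 1" for y
  proof -
    have "?I (y - of_int k) = 0" if "k \<noteq> \<lfloor>y\<rfloor>" for k
    proof -
      have "\<not> (0 \<le> y - of_int k \<and> y - of_int k < 1)"
        using that by linarith
      then show ?thesis
        by auto
    qed
    moreover have "?I (y - of_int \<lfloor>y\<rfloor>) = 1"
      by (simp add: indicator_def) linarith
    ultimately show ?thesis
      by (subst nn_integral_count_space'[of "{\<lfloor>y\<rfloor>}"]) auto
  qed
  have "(\<integral>\<^sup>+y. f y \<partial>lborel)
      = (\<integral>\<^sup>+y. (\<integral>\<^sup>+k. f y * ?I (y - of_int k) \<partial>count_space (UNIV :: int set)) \<partial>lborel)"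
    by (simp add: nn_integral_cmult tiling)
  also have "\<dots> = (\<integral>\<^sup>+k. (\<integral>\<^sup>+y. f y * ?I (y - of_int k) \<partial>lborel) \<partial>count_space (UNIV :: int set))"
    by (rule nn_integral_count_space_nn_integral) auto
  also have "\<dots> = (\<integral>\<^sup>+k. (\<integral>\<^sup>+u. f (u + of_int k) * ?I u \<partial>lborel) \<partial>count_space (UNIV :: int set))"
  proof (rule nn_integral_cong)
    fix k :: int
    show "(\<integral>\<^sup>+y. f y * ?I (y - of_int k) \<partial>lborel) = (\<integral>\<^sup>+u. f (u + of_int k) * ?I u \<partial>lborel)"
      by (subst nn_integral_real_affine[where c = 1 and t = "of_int k"]) (auto simp: add.commute)
  qed
  also have "\<dots> = (\<integral>\<^sup>+u. (\<integral>\<^sup>+k. f (u + of_int k) * ?I u \<partial>count_space (UNIV :: int set)) \<partial>lborel)"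
    by (rule nn_integral_count_space_nn_integral[symmetric]) auto
  finally show ?thesis
    by (simp add: nn_integral_multc)
qed

section \<open>Uniform distribution modulo one\<close>

lemma borel_measurable_frac [measurable]: "(frac :: real \<Rightarrow> real) \<in> borel_measurable borel"
  unfolding frac_def[abs_def] by measurable

text \<open>
  The event \<open>frac y \<in> A\<close> is invariant under integer translations of \<open>y\<close>, so when its probability
  is folded onto \<open>[0, 1)\<close> only the density gets summed.
\<close>
lemma ud_mod_one_if_translates_sum_to_one:
  assumes pdf: "has_pdf M Y g"
    and one: "\<And>u. (\<integral>\<^sup>+k. ennreal (g (u + of_int k)) \<partial>count_space (UNIV :: int set)) = 1"
  shows "ud_mod_one M Y"
proof -
  have dist: "distributed M lborel Y (\<lambda>x. ennreal (g x))"
    using pdf by (simp add: has_pdf_def)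
  have [measurable]: "Y \<in> borel_measurable M" "(\<lambda>x. ennreal (g x)) \<in> borel_measurable borel"
    using distributed_measurable[OF dist] distributed_borel_measurable[OF dist] by simp_all
  have "distr M borel (\<lambda>\<omega>. frac (Y \<omega>)) = uniform_measure lborel {0..<1}"
  proof (rule measure_eqI)
    fix A assume "A \<in> sets (distr M borel (\<lambda>\<omega>. frac (Y \<omega>)))"
    then have [measurable]: "A \<in> sets borel"
      by simp
    have frac_unit: "indicator A (frac u) * indicator {0..<1} u
        = (indicator A u * indicator {0..<1} u :: ennreal)" for u :: real
      by (auto simp: frac_eq split: split_indicator)
    have frac_shift: "frac (u + of_int k) = frac u" for u :: real and k :: int
      by (simp add: frac_def)
    have "emeasure (distr M borel (\<lambda>\<omega>. frac (Y \<omega>))) A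
        = (\<integral>\<^sup>+\<omega>. indicator A (frac (Y \<omega>)) \<partial>M)"
      by (simp add: nn_integral_distr flip: nn_integral_indicator)
    also have "\<dots> = (\<integral>\<^sup>+y. ennreal (g y) * indicator A (frac y) \<partial>lborel)"
      by (rule distributed_nn_integral[OF dist, symmetric]) simp
    also have "\<dots> = (\<integral>\<^sup>+u. (\<integral>\<^sup>+k. ennreal (g (u + of_int k)) * indicator A (frac (u + of_int k))
        \<partial>count_space (UNIV :: int set)) * indicator {0..<1} u \<partial>lborel)"
      by (rule nn_integral_lborel_periodize) simp
    also have "\<dots> = (\<integral>\<^sup>+u. (\<integral>\<^sup>+k. ennreal (g (u + of_int k)) \<partial>count_space (UNIV :: int set))
        * (indicator A u * indicator {0..<1} u) \<partial>lborel)"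
      by (simp add: mult.assoc frac_shift frac_unit flip: nn_integral_multc)
    also have "\<dots> = (\<integral>\<^sup>+u. indicator ({0..<1} \<inter> A) u \<partial>lborel)"
      by (simp add: one Int_commute flip: indicator_inter_arith)
    also have "\<dots> = emeasure (uniform_measure lborel {0..<1}) A"
      by (simp add: divide_ennreal_def)
    finally show "emeasure (distr M borel (\<lambda>\<omega>. frac (Y \<omega>))) A
        = emeasure (uniform_measure lborel {0..<1}) A" .
  qed simp
  then show ?thesis
    by (simp add: ud_mod_one_def)
qed

lemma seed_function_translates_sum_to_one:
  assumes "seed_function H"
  shows "(\<integral>\<^sup>+k. ennreal (H (u + of_int k) - H (u + of_int k - 1)) \<partial>count_space (UNIV :: int set)) = 1"
proof -
  let ?F = "\<lambda>k :: int. H (u + of_int k)"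
  have mono: "H (y - 1) \<le> H y" and bot: "(H \<longlongrightarrow> 0) at_bot" and top: "(H \<longlongrightarrow> 1) at_top" for y
    using assms by (auto simp: seed_function_def)
  have "filterlim (\<lambda>n. u + real n) at_top sequentially"
    by (intro filterlim_tendsto_add_at_top[OF tendsto_const] filterlim_real_sequentially)
  then have "(\<lambda>n. ?F (int n)) \<longlonglongrightarrow> 1"
    using filterlim_compose[OF top] by simp
  moreover have "filterlim (\<lambda>n. - (- u + real n)) at_bot sequentially"
    unfolding filterlim_uminus_at_bot minus_minus
    by (intro filterlim_tendsto_add_at_top[OF tendsto_const] filterlim_real_sequentially)
  then have "(\<lambda>n. ?F (- int n)) \<longlonglongrightarrow> 0"
    using filterlim_compose[OF bot] by simp
  ultimately show ?thesis
    using nn_integral_count_space_int_telescope[of ?F 1 0] mono by (simp add: algebra_simps)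
qed

section \<open>Passing to powers of the base\<close>

text \<open>
  The density of \<open>b powr Y\<close> is the one of \<open>Y\<close> at \<open>log b x\<close> times the derivative of \<^term>\<open>log b\<close>.
  Substitution is first done on the compact intervals \<open>{- n..n}\<close>, whose images exhaust the positive
  half-line; monotone convergence gives the whole line.
\<close>
lemma has_pdf_powr:
  fixes b :: real
  assumes b: "1 < b" and pdf: "has_pdf M Y g"
  shows "has_pdf M (\<lambda>\<omega>. b powr Y \<omega>) (\<lambda>x. if 0 < x then g (log b x) / (x * ln b) else 0)"
proof -
  define h where "h x = (if 0 < x then g (log b x) / (x * ln b) else 0)" for x
  have g0: "0 \<le> g y" for y
    using pdf by (simp add: has_pdf_def)
  have dist: "distributed M lborel Y (\<lambda>x. ennreal (g x))"
    using pdf by (simp add: has_pdf_def)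
  have [measurable]: "Y \<in> borel_measurable M" "g \<in> borel_measurable borel"
    using distributed_measurable[OF dist] distributed_real_measurable[OF g0 dist] by simp_all
  have h_measurable [measurable]: "h \<in> borel_measurable borel"
    unfolding h_def log_def by measurable
  have h0: "0 \<le> h x" for x
    using b g0 by (auto simp: h_def intro!: divide_nonneg_nonneg)
  have h_powr: "h (b powr y) * (ln b * b powr y) = g y" for y
    using b by (simp add: h_def)
  have "distr M lborel (\<lambda>\<omega>. b powr Y \<omega>) = density lborel (\<lambda>x. ennreal (h x))"
  proof (rule measure_eqI)
    fix A assume "A \<in> sets (distr M lborel (\<lambda>\<omega>. b powr Y \<omega>))"
    then have [measurable]: "A \<in> sets borel"
      by simp
    let ?lhs = "\<lambda>n y. ennreal (g y) * indicator A (b powr y) * indicator {- real n..real n} y"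
    let ?rhs = "\<lambda>n x. ennreal (h x) * indicator A x * indicator {b powr - real n..b powr real n} x"
    have compact: "integral\<^sup>N lborel (?lhs n) = integral\<^sup>N lborel (?rhs n)" for n
    proof -
      have "(\<integral>\<^sup>+x. ennreal (h x * indicator A x) * indicator {b powr - real n..b powr real n} x \<partial>lborel)
          = (\<integral>\<^sup>+y. ennreal (h (b powr y) * indicator A (b powr y) * (ln b * b powr y))
              * indicator {- real n..real n} y \<partial>lborel)"
      proof -
        have "((\<lambda>y. b powr y) has_real_derivative ln b * b powr y) (at y)" for y
          using b by (auto intro!: derivative_eq_intros)
        moreover have "continuous_on {- real n..real n} (\<lambda>y. ln b * b powr y)"
          using b by (auto intro!: continuous_intros)
        moreover have "set_borel_measurable borel {b powr - real n..b powr real n}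
            (\<lambda>x. h x * indicator A x)"
          unfolding set_borel_measurable_def by measurable
        ultimately show ?thesis
          using b nn_integral_substitution[of "\<lambda>y. b powr y" "- real n" "real n"
              "\<lambda>x. h x * indicator A x" "\<lambda>y. ln b * b powr y"]
          by (simp add: ennreal_mult'' ennreal_indicator flip: times_divide_eq_right)
      qed
      moreover have "h (b powr y) * indicator A (b powr y) * (ln b * b powr y)
          = g y * indicator A (b powr y)" for y
        using h_powr[of y] by (simp add: algebra_simps)
      ultimately show ?thesis
        using h0 g0 by (simp add: ennreal_mult ennreal_indicator)
    qed
    have "(\<lambda>n. integral\<^sup>N lborel (?lhs n))
        \<longlonglongrightarrow> (\<integral>\<^sup>+y. ennreal (g y) * indicator A (b powr y) \<partial>lborel)"
    proof (rule nn_integral_LIMSEQ)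
      show "incseq ?lhs"
        by (auto simp: incseq_def le_fun_def split: split_indicator)
      fix y
      have "\<forall>\<^sub>F n in sequentially. ?lhs n y = ennreal (g y) * indicator A (b powr y)"
        by (rule eventually_sequentiallyI[of "nat \<lceil>\<bar>y\<bar>\<rceil>"])
          (auto simp: abs_le_iff nat_le_iff ceiling_le_iff split: split_indicator)
      then show "(\<lambda>n. ?lhs n y) \<longlonglongrightarrow> ennreal (g y) * indicator A (b powr y)"
        by (rule tendsto_eventually)
    qed simp
    moreover have "(\<lambda>n. integral\<^sup>N lborel (?rhs n)) \<longlonglongrightarrow> (\<integral>\<^sup>+x. ennreal (h x) * indicator A x \<partial>lborel)"
    proof (rule nn_integral_LIMSEQ)
      have "b powr - real n \<le> b powr - real m" "b powr real m \<le> b powr real n" if "m \<le> n" for m n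
        using b that by (auto intro: powr_mono)
      then show "incseq ?rhs"
        by (fastforce simp: incseq_def le_fun_def split: split_indicator)
      fix x
      have "\<forall>\<^sub>F n in sequentially. ?rhs n x = ennreal (h x) * indicator A x"
      proof (cases "0 < x")
        case True
        show ?thesis
        proof (rule eventually_sequentiallyI[of "nat \<lceil>\<bar>log b x\<bar>\<rceil>"])
          fix n assume "nat \<lceil>\<bar>log b x\<bar>\<rceil> \<le> n"
          then have "- real n \<le> log b x" "log b x \<le> real n"
            by linarith+
          then have "b powr - real n \<le> x" "x \<le> b powr real n"
            using b True by (simp_all add: le_log_iff log_le_iff)
          then show "?rhs n x = ennreal (h x) * indicator A x"
            by simp
        qed
      qed (simp add: h_def)
      then show "(\<lambda>n. ?rhs n x) \<longlonglongrightarrow> ennreal (h x) * indicator A x"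
        by (rule tendsto_eventually)
    qed simp
    ultimately have eq: "(\<integral>\<^sup>+y. ennreal (g y) * indicator A (b powr y) \<partial>lborel)
        = (\<integral>\<^sup>+x. ennreal (h x) * indicator A x \<partial>lborel)"
      unfolding compact by (rule LIMSEQ_unique)
    have "emeasure (distr M lborel (\<lambda>\<omega>. b powr Y \<omega>)) A = (\<integral>\<^sup>+\<omega>. indicator A (b powr Y \<omega>) \<partial>M)"
      by (simp add: nn_integral_distr flip: nn_integral_indicator)
    also have "\<dots> = (\<integral>\<^sup>+y. ennreal (g y) * indicator A (b powr y) \<partial>lborel)"
      by (rule distributed_nn_integral[OF dist, symmetric]) simp
    finally show "emeasure (distr M lborel (\<lambda>\<omega>. b powr Y \<omega>)) A
        = emeasure (density lborel (\<lambda>x. ennreal (h x))) A"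
      by (simp add: eq emeasure_density)
  qed simp
  then have "has_pdf M (\<lambda>\<omega>. b powr Y \<omega>) h"
    using h0 by (simp add: has_pdf_def distributed_def)
  then show ?thesis
    by (simp add: h_def[abs_def])
qed

lemma significand_powr:
  assumes "1 < b"
  shows "significand b (b powr y) = b powr frac y"
  unfolding significand_def
proof (rule the1_equality)
  show "\<exists>!s. s \<in> {1..<b} \<and> (\<exists>k::int. b powr y = s * b powi k)"
    using assms by (intro significand_ex1) auto
  have "b powr frac y < b powr 1"
    using assms frac_lt_1 by (intro powr_less_mono) auto
  moreover have "b powr y = b powr frac y * b powi \<lfloor>y\<rfloor>"
    using assms by (simp add: frac_def flip: powr_real_of_int' powr_add)
  ultimately show "b powr frac y \<in> {1..<b} \<and> (\<exists>k::int. b powr y = b powr frac y * b powi k)"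
    using assms by (auto intro: ge_one_powr_ge_zero)
qed

lemma benford_powr_if_ud_mod_one:
  assumes b: "1 < b" and ud: "ud_mod_one M Y" and pdf: "has_pdf M Y g"
  shows "benford b M (\<lambda>\<omega>. b powr Y \<omega>)"
  unfolding benford_def
proof (intro conjI ballI)
  show "\<exists>f. has_pdf M (\<lambda>\<omega>. b powr Y \<omega>) f"
    using has_pdf_powr[OF b pdf] by blast
  show "0 < b powr Y \<omega>" for \<omega>
    using b by simp
  fix s assume "s \<in> {1..<b}"
  then have s: "1 \<le> s" "s < b"
    by auto
  have [measurable]: "Y \<in> borel_measurable M"
    and unif: "distr M borel (\<lambda>\<omega>. frac (Y \<omega>)) = uniform_measure lborel {0..<1}"
    using ud by (auto simp: ud_mod_one_def)
  have log_s: "0 \<le> log b s" "log b s < 1"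
    using b s by auto
  have "{\<omega> \<in> space M. significand b (b powr Y \<omega>) \<le> s} = (\<lambda>\<omega>. frac (Y \<omega>)) -` {..log b s} \<inter> space M"
    using b s by (auto simp: significand_powr le_log_iff)
  then have "measure M {\<omega> \<in> space M. significand b (b powr Y \<omega>) \<le> s}
      = measure (distr M borel (\<lambda>\<omega>. frac (Y \<omega>))) {..log b s}"
    by (simp add: measure_distr)
  also have "\<dots> = measure lborel ({0..<1} \<inter> {..log b s})"
    unfolding unif by (subst measure_uniform_measure) simp_all
  also have "{0..<1} \<inter> {..log b s} = {0..log b s}"
    using log_s by auto
  finally show "measure M {\<omega> \<in> space M. significand b (b powr Y \<omega>) \<le> s} = log b s"
    using log_s by simp
qed

section \<open>Seed functions\<close>

theorem corollary4p2:
  fixes H g :: "real \<Rightarrow> real" and b :: real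
    and M :: "'a measure" and Y :: "'a \<Rightarrow> real"
  assumes "seed_function H"
    and "\<And>y. g y = H y - H (y - 1)"
    and "1 < b"
    and "prob_space M"
    and "has_pdf M Y g"
  shows "ud_mod_one M Y \<and> benford b M (\<lambda>\<omega>. b powr Y \<omega>)"
proof
  show ud: "ud_mod_one M Y"
    using assms(5)
  proof (rule ud_mod_one_if_translates_sum_to_one)
    show "(\<integral>\<^sup>+k. ennreal (g (u + of_int k)) \<partial>count_space (UNIV :: int set)) = 1" for u
      using seed_function_translates_sum_to_one[OF assms(1)] by (simp only: assms(2))
  qed
  show "benford b M (\<lambda>\<omega>. b powr Y \<omega>)"
    using assms(3) ud assms(5) by (rule benford_powr_if_ud_mod_one)
qed

end
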